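(* Let $1\le q\le\infty$. Assume that $\omega_\lambda\ge\gamma>0$ for all $\lambda\in\Lambda$ (so that $K^{(q)}_{v^{(n)},\omega}$ is strictly convex) and $\|T\|<1$. Set $\alpha:=(1+\gamma)^{-1}\|I-T^*T\|<1$. Then the iterative thresholding algorithm $$u^{(n,m+1)}:=U^{(q)}_{v^{(n)},\omega}\big(u^{(n,m)}+T^*(g-Tu^{(n,m)})\big),\qquad m=0,1,2,\dots,$$ converges linearly: $$\|u^{(n,\infty)}-u^{(n,m+1)}\|_2\le\alpha\,\|u^{(n,\infty)}-u^{(n,m)}\|_2 .$$
   Context: $\Lambda$ is a countable index set, $M\in\mathbb{N}$, and $\ell_2(\Lambda,\mathbb{R}^M)$ is the real Hilbert space of families $u=(u_\lambda)_{\lambda\in\Lambda}$, $u_\lambda\in\mathbb{R}^M$, with $\|u\|_2^2=\sum_\lambda\|u_\lambda\|_2^2<\infty$. $\mathcal{H}$ is a separable real Hilbert space, $g\in\mathcal{H}$, and $T:\ell_2(\Lambda,\mathbb{R}^M)\to\mathcal{H}$ is a bounded linear operator. For sequences $v=(v_\lambda)$, $\omega=(\omega_\lambda)$ of non-negative numbers, with $\|\cdot\|_q$ the $\ell_q$-norm on $\mathbb{R}^M$, $$\Psi^{(q)}_{v,\omega}(u)=\sum_{\lambda}v_\lambda\|u_\lambda\|_q+\sum_{\lambda}\omega_\lambda\|u_\lambda\|_2^2\in[0,\infty],\qquad K^{(q)}_{v,\omega}(u)=\|Tu-g\|_{\mathcal{H}}^2+\Psi^{(q)}_{v,\omega}(u),$$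 $$U^{(q)}_{v,\omega}(u)=\arg\min_{z\in\ell_2(\Lambda,\mathbb{R}^M)}\ \|u-z\|_2^2+\Psi^{(q)}_{v,\omega}(z).$$ Here $n$ is a fixed (outer iteration) index, $v^{(n)}=(v^{(n)}_\lambda)_\lambda$ is a fixed sequence of non-negative numbers, $u^{(n,0)}\in\ell_2(\Lambda,\mathbb{R}^M)$ is an arbitrary starting point, and $u^{(n,\infty)}$ denotes the unique minimizer of $K^{(q)}_{v^{(n)},\omega}$ (the limit of the inner iteration), which satisfies $u^{(n,\infty)}=U^{(q)}_{v^{(n)},\omega}\big(u^{(n,\infty)}+T^*(g-Tu^{(n,\infty)})\big)$. *)

theory Defs
  imports "HOL-Analysis.Analysis"
begin

section \<open>The Hilbert space of square-summable families\<close>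

typedef (overloaded) ('i, 'a::real_inner) ell2 =
  "{u :: 'i \<Rightarrow> 'a. (\<lambda>i. (norm (u i))\<^sup>2) summable_on UNIV}"
  morphisms coord Abs_ell2
  by (rule exI[of _ "\<lambda>_. 0"]) simp

setup_lifting type_definition_ell2

lemma coord_summable: "(\<lambda>i. (norm (coord u i))\<^sup>2) summable_on UNIV"
  using coord[of u] by simp

lemma ell2_summable_inner:
  fixes u v :: "'i \<Rightarrow> 'a::real_inner"
  assumes "(\<lambda>i. (norm (u i))\<^sup>2) summable_on UNIV" "(\<lambda>i. (norm (v i))\<^sup>2) summable_on UNIV"
  shows "(\<lambda>i. u i \<bullet> v i) summable_on UNIV"
proof (rule abs_summable_summable[OF Infinite_Sum.abs_summable_on_comparison_test'])
  show "(\<lambda>i. (norm (u i))\<^sup>2 + (norm (v i))\<^sup>2) summable_on UNIV"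
    using assms by (rule summable_on_add)
  fix i
  have "\<bar>u i \<bullet> v i\<bar> \<le> norm (u i) * norm (v i)"
    by (rule Cauchy_Schwarz_ineq2)
  also have "\<dots> \<le> (norm (u i))\<^sup>2 + (norm (v i))\<^sup>2"
    using sum_squares_bound[of "norm (u i)" "norm (v i)"]
      mult_nonneg_nonneg[OF norm_ge_zero[of "u i"] norm_ge_zero[of "v i"]] by linarith
  finally show "norm (u i \<bullet> v i) \<le> (norm (u i))\<^sup>2 + (norm (v i))\<^sup>2" by simp
qed

lemma ell2_summable_add:
  fixes u v :: "'i \<Rightarrow> 'a::real_inner"
  assumes "(\<lambda>i. (norm (u i))\<^sup>2) summable_on UNIV" "(\<lambda>i. (norm (v i))\<^sup>2) summable_on UNIV"
  shows "(\<lambda>i. (norm (u i + v i))\<^sup>2) summable_on UNIV"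
proof -
  have "(\<lambda>i. (norm (u i))\<^sup>2 + 2 * (u i \<bullet> v i) + (norm (v i))\<^sup>2) summable_on UNIV"
    by (intro summable_on_add summable_on_cmult_right ell2_summable_inner assms)
  moreover have "(norm (u i + v i))\<^sup>2 = (norm (u i))\<^sup>2 + 2 * (u i \<bullet> v i) + (norm (v i))\<^sup>2" for i
    unfolding power2_norm_eq_inner by (simp only: inner_add_left inner_add_right inner_commute)
  ultimately show ?thesis by simp
qed

lemma ell2_summable_scaleR:
  fixes u :: "'i \<Rightarrow> 'a::real_inner"
  assumes "(\<lambda>i. (norm (u i))\<^sup>2) summable_on UNIV"
  shows "(\<lambda>i. (norm (c *\<^sub>R u i))\<^sup>2) summable_on UNIV"
  using summable_on_cmult_right[OF assms, of "c\<^sup>2"] by (simp add: power_mult_distrib)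

instantiation ell2 :: (type, real_inner) real_inner
begin

lift_definition zero_ell2 :: "('a, 'b) ell2" is "\<lambda>_. 0" by simp

lift_definition plus_ell2 :: "('a, 'b) ell2 \<Rightarrow> ('a, 'b) ell2 \<Rightarrow> ('a, 'b) ell2"
  is "\<lambda>u v i. u i + v i" by (rule ell2_summable_add)

lift_definition uminus_ell2 :: "('a, 'b) ell2 \<Rightarrow> ('a, 'b) ell2"
  is "\<lambda>u i. - u i" by simp

lift_definition minus_ell2 :: "('a, 'b) ell2 \<Rightarrow> ('a, 'b) ell2 \<Rightarrow> ('a, 'b) ell2"
  is "\<lambda>u v i. u i - v i"
  subgoal for u v using ell2_summable_add[of u "\<lambda>i. - v i"] by simp
  done

lift_definition scaleR_ell2 :: "real \<Rightarrow> ('a, 'b) ell2 \<Rightarrow> ('a, 'b) ell2"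
  is "\<lambda>c u i. c *\<^sub>R u i" by (rule ell2_summable_scaleR)

lift_definition inner_ell2 :: "('a, 'b) ell2 \<Rightarrow> ('a, 'b) ell2 \<Rightarrow> real"
  is "\<lambda>u v. \<Sum>\<^sub>\<infinity>i. u i \<bullet> v i" .

definition norm_ell2 :: "('a, 'b) ell2 \<Rightarrow> real"
  where "norm_ell2 u = sqrt (u \<bullet> u)"

definition sgn_ell2 :: "('a, 'b) ell2 \<Rightarrow> ('a, 'b) ell2"
  where "sgn_ell2 u = scaleR (inverse (norm u)) u"

definition dist_ell2 :: "('a, 'b) ell2 \<Rightarrow> ('a, 'b) ell2 \<Rightarrow> real"
  where "dist_ell2 u v = norm (u - v)"

definition uniformity_ell2 :: "(('a, 'b) ell2 \<times> ('a, 'b) ell2) filter"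
  where "uniformity_ell2 = (INF e\<in>{0<..}. principal {(x, y). dist x y < e})"

definition open_ell2 :: "('a, 'b) ell2 set \<Rightarrow> bool"
  where "open_ell2 S = (\<forall>x\<in>S. \<forall>\<^sub>F (x', y) in uniformity. x' = x \<longrightarrow> y \<in> S)"

instance
proof
  fix u v w :: "('a, 'b) ell2" and a b r :: real
  show "u + v + w = u + (v + w)" by transfer (simp add: algebra_simps)
  show "u + v = v + u" by transfer (simp add: algebra_simps)
  show "0 + u = u" by transfer simp
  show "- u + u = 0" by transfer simp
  show "u - v = u + - v" by transfer simp
  show "a *\<^sub>R (u + v) = a *\<^sub>R u + a *\<^sub>R v" by transfer (simp add: scaleR_add_right)
  show "(a + b) *\<^sub>R u = a *\<^sub>R u + b *\<^sub>R u" by transfer (simp add: scaleR_add_left)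
  show "a *\<^sub>R b *\<^sub>R u = (a * b) *\<^sub>R u" by transfer simp
  show "1 *\<^sub>R u = u" by transfer simp
  show "dist u v = norm (u - v)" by (rule dist_ell2_def)
  show "sgn u = scaleR (inverse (norm u)) u" by (rule sgn_ell2_def)
  show "norm u = sqrt (u \<bullet> u)" by (rule norm_ell2_def)
  show "u \<bullet> v = v \<bullet> u" by transfer (simp add: inner_commute)
  show "(u + v) \<bullet> w = u \<bullet> w + v \<bullet> w"
    by transfer (simp add: inner_add_left infsum_add ell2_summable_inner)
  show "(r *\<^sub>R u) \<bullet> v = r * (u \<bullet> v)"
    by transfer (simp add: infsum_cmult_right ell2_summable_inner)
  show "0 \<le> u \<bullet> u" by transfer (simp add: infsum_nonneg)
  show "(u \<bullet> u = 0) = (u = 0)"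
  proof transfer
    fix u :: "'a \<Rightarrow> 'b"
    assume s: "(\<lambda>i. (norm (u i))\<^sup>2) summable_on UNIV"
    show "((\<Sum>\<^sub>\<infinity>i. u i \<bullet> u i) = 0) = (u = (\<lambda>_. 0))"
    proof
      assume z: "(\<Sum>\<^sub>\<infinity>i. u i \<bullet> u i) = 0"
      have "u i \<bullet> u i = 0" for i
        using z ell2_summable_inner[OF s s]
        by (rule nonneg_infsum_le_0D[where A = UNIV, OF eq_refl]) auto
      then show "u = (\<lambda>_. 0)" by auto
    qed simp
  qed
qed (fact uniformity_ell2_def open_ell2_def)+

end

lemma norm_ell2_power2: "(norm u)\<^sup>2 = (\<Sum>\<^sub>\<infinity>i. (norm (coord u i))\<^sup>2)"
  by (simp add: power2_norm_eq_inner inner_ell2.rep_eq del: dot_square_norm)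

lemma ell2_sum_le:
  assumes "finite F"
  shows "(\<Sum>i\<in>F. (norm (coord u i))\<^sup>2) \<le> (norm u)\<^sup>2"
  unfolding norm_ell2_power2
  by (rule finite_sum_le_infsum[OF coord_summable assms subset_UNIV zero_le_power2])

lemma norm_coord_le: "norm (coord u i) \<le> norm u"
proof (rule power2_le_imp_le)
  show "(norm (coord u i))\<^sup>2 \<le> (norm u)\<^sup>2"
    using ell2_sum_le[of "{i}" u] by simp
qed (rule norm_ge_zero)

text \<open>Over a complete coefficient space, \<open>ell2\<close> is a Hilbert space.\<close>

instance ell2 :: (type, "{real_inner, complete_space}") complete_space
proof
  fix X :: "nat \<Rightarrow> ('a, 'b) ell2"
  assume C: "Cauchy X"
  have "Cauchy (\<lambda>n. coord (X n) i)" for i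
  proof (rule metric_CauchyI)
    fix e :: real assume "e > 0"
    then obtain N where "\<And>m n. m \<ge> N \<Longrightarrow> n \<ge> N \<Longrightarrow> dist (X m) (X n) < e"
      using metric_CauchyD[OF C] by blast
    then show "\<exists>N. \<forall>m\<ge>N. \<forall>n\<ge>N. dist (coord (X m) i) (coord (X n) i) < e"
      by (metis dist_norm le_less_trans minus_ell2.rep_eq norm_coord_le)
  qed
  then have "\<forall>i. \<exists>l. (\<lambda>n. coord (X n) i) \<longlonglongrightarrow> l"
    by (simp add: Cauchy_convergent_iff convergent_def)
  then obtain l where l: "\<And>i. (\<lambda>n. coord (X n) i) \<longlonglongrightarrow> l i" by metis
  have tail: "(\<Sum>i\<in>F. (norm (coord (X n) i - l i))\<^sup>2) \<le> e\<^sup>2"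
    if N: "\<And>m. m \<ge> N \<Longrightarrow> dist (X n) (X m) < e" and F: "finite F" for n N e F
  proof (rule tendsto_upperbound)
    show "(\<lambda>m. \<Sum>i\<in>F. (norm (coord (X n) i - coord (X m) i))\<^sup>2)
            \<longlonglongrightarrow> (\<Sum>i\<in>F. (norm (coord (X n) i - l i))\<^sup>2)"
      by (intro tendsto_intros l)
    show "\<forall>\<^sub>F m in sequentially. (\<Sum>i\<in>F. (norm (coord (X n) i - coord (X m) i))\<^sup>2) \<le> e\<^sup>2"
      using eventually_ge_at_top[of N]
    proof eventually_elim
      case (elim m)
      have "(\<Sum>i\<in>F. (norm (coord (X n - X m) i))\<^sup>2) \<le> (norm (X n - X m))\<^sup>2"
        by (rule ell2_sum_le[OF F])
      also have "\<dots> \<le> e\<^sup>2"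
        using N[OF elim] by (intro power_mono) (auto simp: dist_norm)
      finally show ?case by (simp add: minus_ell2.rep_eq)
    qed
  qed simp
  have summ: "(\<lambda>i. (norm (coord (X n) i - l i))\<^sup>2) summable_on UNIV"
    if N: "\<And>m. m \<ge> N \<Longrightarrow> dist (X n) (X m) < e" for n N e
    using tail[OF N] by (intro nonneg_bdd_above_summable_on bdd_aboveI[of _ "e\<^sup>2"]) auto
  obtain N1 where N1: "\<And>m n. m \<ge> N1 \<Longrightarrow> n \<ge> N1 \<Longrightarrow> dist (X m) (X n) < 1"
    using metric_CauchyD[OF C, of 1] by auto
  have "(\<lambda>i. (norm (coord (X N1) i + - (coord (X N1) i - l i)))\<^sup>2) summable_on UNIV"
    by (intro ell2_summable_add coord_summable)
      (simp only: norm_minus_cancel, rule summ[of N1 N1 1], simp add: N1)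
  then have "(\<lambda>i. (norm (l i))\<^sup>2) summable_on UNIV" by simp
  then have cL: "coord (Abs_ell2 l) = l" by (simp add: Abs_ell2_inverse)
  have "X \<longlonglongrightarrow> Abs_ell2 l"
  proof (rule metric_LIMSEQ_I)
    fix r :: real assume "r > 0"
    then obtain N where N: "\<And>m n. m \<ge> N \<Longrightarrow> n \<ge> N \<Longrightarrow> dist (X m) (X n) < r / 2"
      using metric_CauchyD[OF C, of "r / 2"] by auto
    have "dist (X n) (Abs_ell2 l) < r" if "n \<ge> N" for n
    proof -
      have n: "\<And>m. m \<ge> N \<Longrightarrow> dist (X n) (X m) < r / 2" using N that by simp
      have "(norm (X n - Abs_ell2 l))\<^sup>2 \<le> (r / 2)\<^sup>2"
        unfolding norm_ell2_power2 minus_ell2.rep_eq cL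
        using summ[OF n] tail[OF n] by (rule infsum_le_finite_sums)
      then have "norm (X n - Abs_ell2 l) \<le> r / 2"
        by (rule power2_le_imp_le) (use \<open>r > 0\<close> in simp)
      then show ?thesis using \<open>r > 0\<close> by (simp add: dist_norm)
    qed
    then show "\<exists>N. \<forall>n\<ge>N. dist (X n) (Abs_ell2 l) < r" by blast
  qed
  then show "convergent X" by (auto simp: convergent_def)
qed

section \<open>The functionals\<close>

definition lq_norm :: "ereal \<Rightarrow> real ^ 'm \<Rightarrow> real" where
  "lq_norm q x =
     (if q = \<infinity> then Max (range (\<lambda>k. \<bar>x $ k\<bar>))
      else (\<Sum>k\<in>UNIV. \<bar>x $ k\<bar> powr real_of_ereal q) powr (1 / real_of_ereal q))"

definition Psi ::
  "ereal \<Rightarrow> ('i \<Rightarrow> real) \<Rightarrow> ('i \<Rightarrow> real) \<Rightarrow> ('i, real ^ 'm) ell2 \<Rightarrow> ennreal" where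
  "Psi q v \<omega> u = (\<Sum>\<^sub>\<infinity>i. ennreal (v i * lq_norm q (coord u i)))
                 + (\<Sum>\<^sub>\<infinity>i. ennreal (\<omega> i * (norm (coord u i))\<^sup>2))"

definition K_functional ::
  "ereal \<Rightarrow> ('i \<Rightarrow> real) \<Rightarrow> ('i \<Rightarrow> real) \<Rightarrow> (('i, real ^ 'm) ell2 \<Rightarrow> 'h::real_inner) \<Rightarrow> 'h
    \<Rightarrow> ('i, real ^ 'm) ell2 \<Rightarrow> ennreal" where
  "K_functional q v \<omega> T g u = ennreal ((norm (T u - g))\<^sup>2) + Psi q v \<omega> u"

text \<open>\<^const>\<open>arg_min\<close> is a choice operator. In the two definitions below it denotes the
  minimizer whenever the minimizer exists and is unique; this holds for the first as soon as the
  weights are non-negative, and for the second when moreover \<open>\<omega>\<close> is bounded below by a positive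
  constant and \<open>T\<close> is bounded linear.\<close>

definition thresh ::
  "ereal \<Rightarrow> ('i \<Rightarrow> real) \<Rightarrow> ('i \<Rightarrow> real) \<Rightarrow> ('i, real ^ 'm) ell2 \<Rightarrow> ('i, real ^ 'm) ell2" where
  "thresh q v \<omega> u = arg_min (\<lambda>z. ennreal ((norm (u - z))\<^sup>2) + Psi q v \<omega> z) (\<lambda>_. True)"

definition K_minimizer ::
  "ereal \<Rightarrow> ('i \<Rightarrow> real) \<Rightarrow> ('i \<Rightarrow> real) \<Rightarrow> (('i, real ^ 'm) ell2 \<Rightarrow> 'h::real_inner) \<Rightarrow> 'h
    \<Rightarrow> ('i, real ^ 'm) ell2" where
  "K_minimizer q v \<omega> T g = arg_min (K_functional q v \<omega> T g) (\<lambda>_. True)"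

end

theory Submission
  imports Defs
begin

text \<open>
  Splitting \<open>\<gamma> \<parallel>u\<parallel>\<^sup>2\<close> off the penalty leaves a convex lower semicontinuous \<open>P\<close>, so the fixed
  functional and every thresholding step minimize \<open>\<parallel>A z - b\<parallel>\<^sup>2 + \<gamma> \<parallel>z\<parallel>\<^sup>2 + P z\<close>, with \<open>A = T\<close> and
  \<open>A = I\<close> respectively. Minimizing sequences are Cauchy by the parallelogram law, so minimizers exist,
  and each satisfies a variational inequality. Testing the inequality for the minimizer \<open>s\<close> of the
  functional against the iterate \<open>p\<close> and conversely, the values of \<open>P\<close> cancel in the sum, which
  becomes \<open>(1 + \<gamma>) \<parallel>s - p\<parallel>\<^sup>2 \<le> \<langle>(I - T\<^sup>*T)(s - u), s - p\<rangle>\<close>.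
\<close>

section \<open>Regularized least squares in a Hilbert space\<close>

text \<open>Convexity and lower semicontinuity are stated for the epigraph, with real bounds, so
  that no products or differences have to be formed in \<open>ennreal\<close>.\<close>

locale convex_lsc =
  fixes P :: "'x::{real_inner, complete_space} \<Rightarrow> ennreal"
  assumes finite_zero: "P 0 < top"
    and convex: "\<And>x y a b t. \<lbrakk>P x \<le> ennreal a; P y \<le> ennreal b; 0 \<le> a; 0 \<le> b; 0 \<le> t; t \<le> 1\<rbrakk>
      \<Longrightarrow> P ((1 - t) *\<^sub>R x + t *\<^sub>R y) \<le> ennreal ((1 - t) * a + t * b)"
    and lsc: "\<And>X x c b. \<lbrakk>X \<longlonglongrightarrow> x; c \<longlonglongrightarrow> b; \<And>n. P (X n) \<le> ennreal (c n)\<rbrakk> \<Longrightarrow> P x \<le> ennreal b"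

text \<open>The quadratic part is a single real under \<open>ennreal\<close>, ready for expansion by
  inner products; only \<open>P\<close> can take the value \<open>top\<close>.\<close>

definition tikhonov ::
  "('x::real_inner \<Rightarrow> 'h::real_inner) \<Rightarrow> 'h \<Rightarrow> real \<Rightarrow> ('x \<Rightarrow> ennreal) \<Rightarrow> 'x \<Rightarrow> ennreal" where
  "tikhonov A b \<gamma> P z = ennreal ((norm (A z - b))\<^sup>2 + \<gamma> * (norm z)\<^sup>2) + P z"

text \<open>The negative term is the strong convexity that makes minimizing sequences
  Cauchy.\<close>

lemma parallelogram_midpoint:
  fixes x y :: "'a::real_inner"
  shows "(norm ((1 / 2) *\<^sub>R x + (1 / 2) *\<^sub>R y))\<^sup>2 =
    ((norm x)\<^sup>2 + (norm y)\<^sup>2) / 2 - (norm (x - y))\<^sup>2 / 4"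
  by (simp add: power2_norm_eq_inner inner_add_left inner_add_right inner_diff_left
      inner_diff_right inner_commute del: dot_square_norm) (simp add: field_simps)

lemma power2_norm_segment:
  fixes x y :: "'a::real_inner"
  shows "(norm (x + t *\<^sub>R y))\<^sup>2 = (norm x)\<^sup>2 + 2 * t * (x \<bullet> y) + t\<^sup>2 * (norm y)\<^sup>2"
  unfolding power2_norm_eq_inner
  by (simp add: inner_add_left inner_add_right inner_commute power2_eq_square algebra_simps
      del: dot_square_norm)

text \<open>Divide by \<open>t\<close> and let \<open>t\<close> tend to 0 from the right. This
  extracts first-order conditions from one-sided perturbations.\<close>

lemma nonneg_limit_linear:
  fixes a b :: real
  assumes "\<And>t. 0 < t \<Longrightarrow> t \<le> 1 \<Longrightarrow> 0 \<le> t * a + t\<^sup>2 * b"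
  shows "0 \<le> a"
proof (rule tendsto_lowerbound)
  show "((\<lambda>t. a + t * b) \<longlongrightarrow> a) (at_right 0)"
    by (rule tendsto_eq_intros refl | simp)+
  have "\<forall>\<^sub>F t in at_right 0. 0 < t \<and> t \<le> (1::real)"
    unfolding eventually_at_right_field by (rule exI[of _ 1]) auto
  then show "\<forall>\<^sub>F t in at_right 0. 0 \<le> a + t * b"
  proof eventually_elim
    case (elim t)
    have "t * a + t\<^sup>2 * b = t * (a + t * b)" by (simp add: power2_eq_square algebra_simps)
    then show ?case using assms[of t] elim by (simp add: zero_le_mult_iff)
  qed
qed simp

section \<open>Existence of minimizers and the variational inequality\<close>

context convex_lsc
begin

lemma finite_minimizer:
  assumes min: "\<And>z. tikhonov A b \<gamma> P p \<le> tikhonov A b \<gamma> P z"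
  obtains a where "0 \<le> a" "P p = ennreal a"
proof -
  have "tikhonov A b \<gamma> P p < top"
    by (rule le_less_trans[OF min[of 0]]) (use finite_zero in \<open>auto simp: tikhonov_def\<close>)
  then have "P p < top" by (auto simp: tikhonov_def)
  then show thesis using that by (cases "P p") auto
qed

lemma exists_minimizer:
  fixes A :: "'x \<Rightarrow> 'h::real_inner"
  assumes A: "bounded_linear A" and \<gamma>: "0 < \<gamma>"
  shows "\<exists>p. \<forall>z. tikhonov A b \<gamma> P p \<le> tikhonov A b \<gamma> P z"
proof -
  interpret A: bounded_linear A by (rule A)
  define Q where "Q z = (norm (A z - b))\<^sup>2 + \<gamma> * (norm z)\<^sup>2" for z
  have Q0: "0 \<le> Q z" for z using \<gamma> by (simp add: Q_def)
  \<comment> \<open>The gain comes from the \<open>\<gamma>\<close> term alone; the corresponding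
    nonnegative gain in the \<open>A\<close> term is dropped.\<close>
  have mid: "Q ((1 / 2) *\<^sub>R x + (1 / 2) *\<^sub>R y) \<le> (Q x + Q y) / 2 - \<gamma> / 4 * (norm (x - y))\<^sup>2" for x y
  proof -
    have A_mid: "A ((1 / 2) *\<^sub>R x + (1 / 2) *\<^sub>R y) - b = (1 / 2) *\<^sub>R (A x - b) + (1 / 2) *\<^sub>R (A y - b)"
      by (simp add: A.add A.scaleR algebra_simps flip: scaleR_add_left)
    show ?thesis
      unfolding Q_def A_mid parallelogram_midpoint by (simp add: algebra_simps add_divide_distrib)
  qed
  \<comment> \<open>Minimizing \<open>Q z + a\<close> over the epigraph of \<open>P\<close> keeps
    the infimum in the reals.\<close>
  define S where "S = {(z, a). 0 \<le> a \<and> P z \<le> ennreal a}"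
  define J where "J = (\<lambda>(z, a). Q z + a)"
  define I where "I = Inf (J ` S)"
  have bdd: "bdd_below (J ` S)"
    by (rule bdd_belowI[of _ 0]) (auto simp: J_def S_def Q0)
  obtain a0 where "0 \<le> a0" "P 0 = ennreal a0"
    using finite_zero by (cases "P 0") auto
  then have "(0, a0) \<in> S" by (simp add: S_def)
  then have ne: "J ` S \<noteq> {}" by blast
  have I_le: "I \<le> Q z + a" if "0 \<le> a" "P z \<le> ennreal a" for z a
    unfolding I_def by (rule cInf_lower2[OF _ _ bdd, of "J (z, a)"]) (use that in \<open>auto simp: S_def J_def\<close>)
  have "\<exists>z a. 0 \<le> a \<and> P z \<le> ennreal a \<and> Q z + a < I + inverse (real (Suc n))" for n
  proof -
    have "Inf (J ` S) < I + inverse (real (Suc n))" by (simp add: I_def)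
    then show ?thesis
      unfolding cInf_less_iff[OF ne bdd] by (auto simp: S_def J_def)
  qed
  then obtain z a where za: "\<And>n. 0 \<le> a n" "\<And>n. P (z n) \<le> ennreal (a n)"
      "\<And>n. Q (z n) + a n < I + inverse (real (Suc n))"
    by metis
  \<comment> \<open>The midpoint has value at least \<open>I\<close>, while the two endpoints exceed
    \<open>I\<close> by less than \<open>1/(m+1)\<close> and \<open>1/(n+1)\<close>;
    \<open>mid\<close> converts this into a bound on the distance.\<close>
  have close: "\<gamma> / 4 * (norm (z m - z n))\<^sup>2 \<le> (inverse (real (Suc m)) + inverse (real (Suc n))) / 2"
    for m n
  proof -
    have "P ((1 / 2) *\<^sub>R z m + (1 / 2) *\<^sub>R z n) \<le> ennreal ((a m + a n) / 2)"
      using convex[OF za(2) za(2) za(1) za(1), of "1/2" m n] by (simp add: field_simps)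
    then have "I \<le> Q ((1 / 2) *\<^sub>R z m + (1 / 2) *\<^sub>R z n) + (a m + a n) / 2"
      by (rule I_le[rotated]) (simp add: za(1))
    then show ?thesis
      using mid[of "z m" "z n"] za(3)[of m] za(3)[of n] by argo
  qed
  have "Cauchy z"
  proof (rule metric_CauchyI)
    fix e :: real assume "0 < e"
    then have "0 < \<gamma> / 4 * e\<^sup>2" using \<gamma> by simp
    then obtain N where N: "inverse (real (Suc N)) < \<gamma> / 4 * e\<^sup>2"
      using reals_Archimedean by blast
    have "dist (z m) (z n) < e" if "N \<le> m" "N \<le> n" for m n
    proof -
      have "inverse (real (Suc m)) \<le> inverse (real (Suc N))"
        "inverse (real (Suc n)) \<le> inverse (real (Suc N))"
        using that by (auto intro!: le_imp_inverse_le)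
      then have "\<gamma> / 4 * (norm (z m - z n))\<^sup>2 < \<gamma> / 4 * e\<^sup>2" using close[of m n] N by argo
      then have "(norm (z m - z n))\<^sup>2 < e\<^sup>2" using \<gamma> by simp
      then show ?thesis
        using \<open>0 < e\<close> by (simp add: dist_norm power2_less_imp_less)
    qed
    then show "\<exists>M. \<forall>m\<ge>M. \<forall>n\<ge>M. dist (z m) (z n) < e" by blast
  qed
  then obtain p where p: "z \<longlonglongrightarrow> p" by (auto simp: Cauchy_convergent_iff convergent_def)
  have "(\<lambda>n. I + inverse (real (Suc n)) - Q (z n)) \<longlonglongrightarrow> I + 0 - Q p"
    unfolding Q_def by (intro tendsto_intros A.tendsto p LIMSEQ_inverse_real_of_nat)
  then have Pp: "P p \<le> ennreal (I - Q p)"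
  proof (intro lsc[OF p])
    show "P (z n) \<le> ennreal (I + inverse (real (Suc n)) - Q (z n))" for n
      by (rule order_trans[OF za(2)]) (use za(3)[of n] in \<open>simp add: ennreal_leI\<close>)
  qed simp
  \<comment> \<open>Needed because \<open>ennreal\<close> truncates negative numbers to 0: only now
    does \<open>ennreal (I - Q p)\<close> add up with \<open>ennreal (Q p)\<close> to
    \<open>ennreal I\<close>.\<close>
  have "Q p \<le> I"
  proof (rule LIMSEQ_le)
    show "(\<lambda>n. Q (z n)) \<longlonglongrightarrow> Q p"
      unfolding Q_def by (intro tendsto_intros A.tendsto p)
    show "(\<lambda>n. I + inverse (real (Suc n))) \<longlonglongrightarrow> I"
      using tendsto_add[OF tendsto_const LIMSEQ_inverse_real_of_nat] by simp
    show "\<exists>N. \<forall>n\<ge>N. Q (z n) \<le> I + inverse (real (Suc n))"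
      using za(1,3) by (meson add_increasing2 le_less_trans less_imp_le order_refl)
  qed
  have "tikhonov A b \<gamma> P p \<le> tikhonov A b \<gamma> P y" for y
  proof (cases "P y")
    case (real c)
    have "tikhonov A b \<gamma> P p \<le> ennreal (Q p) + ennreal (I - Q p)"
      unfolding tikhonov_def Q_def[symmetric] by (intro add_left_mono Pp)
    also have "\<dots> = ennreal I" using \<open>Q p \<le> I\<close> Q0 by (simp flip: ennreal_plus)
    also have "\<dots> \<le> ennreal (Q y + c)" using I_le real by (intro ennreal_leI) auto
    also have "\<dots> = tikhonov A b \<gamma> P y"
      using real Q0[of y] by (simp add: tikhonov_def flip: Q_def)
    finally show ?thesis .
  qed (simp add: tikhonov_def)
  then show ?thesis by blast
qed

text \<open>Move from \<open>p\<close> a fraction \<open>t\<close> of the way towards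
  \<open>z\<close>. Convexity changes \<open>P\<close> by at most \<open>t * (c - a)\<close>, the
  quadratic part expands exactly, and the coefficient of \<open>t\<close> must be
  nonnegative.\<close>

lemma minimizer_variational:
  fixes A :: "'x \<Rightarrow> 'h::real_inner"
  assumes A: "bounded_linear A" and \<gamma>: "0 < \<gamma>"
    and min: "\<And>z. tikhonov A b \<gamma> P p \<le> tikhonov A b \<gamma> P z"
    and Pp: "P p = ennreal a" "0 \<le> a"
    and Pz: "P z = ennreal c" "0 \<le> c"
  shows "0 \<le> c - a + 2 * ((A p - b) \<bullet> A (z - p)) + 2 * \<gamma> * (p \<bullet> (z - p))"
proof (rule nonneg_limit_linear)
  interpret A: bounded_linear A by (rule A)
  fix t :: real assume t: "0 < t" "t \<le> 1"
  define w where "w = (1 - t) *\<^sub>R p + t *\<^sub>R z"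
  define Q where "Q z = (norm (A z - b))\<^sup>2 + \<gamma> * (norm z)\<^sup>2" for z
  have Q0: "0 \<le> Q x" for x using \<gamma> by (simp add: Q_def)
  have w: "w = p + t *\<^sub>R (z - p)" by (simp add: w_def algebra_simps)
  have Aw: "A w - b = (A p - b) + t *\<^sub>R A (z - p)" by (simp add: w A.add A.scaleR)
  have "ennreal (Q p + a) \<le> ennreal (Q w) + P w"
    using min[of w] Pp Q0[of p] by (simp add: tikhonov_def flip: Q_def)
  also have "\<dots> \<le> ennreal (Q w) + ennreal ((1 - t) * a + t * c)"
    unfolding w_def by (intro add_left_mono convex) (use Pp Pz t in auto)
  also have "\<dots> = ennreal (Q w + ((1 - t) * a + t * c))"
    using Q0[of w] Pp Pz t by simp
  finally have "Q p + a \<le> Q w + ((1 - t) * a + t * c)"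
    using Q0[of w] Pp Pz t by (subst (asm) ennreal_le_iff) auto
  then show "0 \<le> t * (c - a + 2 * ((A p - b) \<bullet> A (z - p)) + 2 * \<gamma> * (p \<bullet> (z - p)))
      + t\<^sup>2 * ((norm (A (z - p)))\<^sup>2 + \<gamma> * (norm (z - p))\<^sup>2)"
    unfolding Q_def Aw unfolding w power2_norm_segment by (simp add: algebra_simps)
qed

end

section \<open>Adjoints of bounded operators\<close>

text \<open>The representing vector is a multiple of the minimizer of \<open>(f z - 1)\<^sup>2 + \<parallel>z\<parallel>\<^sup>2\<close>.\<close>

lemma Riesz_representation:
  fixes f :: "'x::{real_inner, complete_space} \<Rightarrow> real"
  assumes f: "bounded_linear f"
  shows "\<exists>y. \<forall>x. f x = x \<bullet> y"
proof -
  interpret f: bounded_linear f by (rule f)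
  interpret convex_lsc "\<lambda>_::'x. 0::ennreal" by unfold_locales auto
  obtain p where p: "\<And>z. tikhonov f 1 1 (\<lambda>_. 0) p \<le> tikhonov f 1 1 (\<lambda>_. 0) z"
    using exists_minimizer[OF f, of 1 1] by auto
  have le: "0 \<le> (f p - 1) * f h + p \<bullet> h" for h
    using minimizer_variational[OF f _ p, where a = 0 and z = "p + h" and c = 0] by simp
  have eq: "(1 - f p) * f h = h \<bullet> p" for h
    using le[of h] le[of "- h"] by (simp add: f.neg inner_commute algebra_simps)
  \<comment> \<open>If \<open>f p = 1\<close>, then \<open>eq\<close> at \<open>h = p\<close> gives
    \<open>p = 0\<close>, hence \<open>f p = 0\<close>.\<close>
  have "f p \<noteq> 1" using eq[of p] f.zero by auto
  then have "f h = h \<bullet> ((1 / (1 - f p)) *\<^sub>R p)" for h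
    using eq[of h] by (simp add: field_simps)
  then show ?thesis by blast
qed

text \<open>\<open>adjoint\<close> is defined by choice, so its characteristic identity holds once
  some adjoint exists; the Riesz representation of \<open>T x \<bullet> y\<close> as a functional of
  \<open>x\<close> supplies one for each \<open>y\<close>.\<close>

lemma adjoint_inner:
  fixes T :: "'x::{real_inner, complete_space} \<Rightarrow> 'h::real_inner"
  assumes "bounded_linear T"
  shows "T x \<bullet> y = x \<bullet> adjoint T y"
proof -
  have "\<exists>w. \<forall>x. T x \<bullet> y = x \<bullet> w" for y
    by (rule Riesz_representation) (rule bounded_linear_compose[OF bounded_linear_inner_left assms])
  then have "\<exists>S. \<forall>x y. T x \<bullet> y = x \<bullet> S y" by metis
  then have "\<forall>x y. T x \<bullet> y = x \<bullet> adjoint T y" unfolding adjoint_def by (rule someI_ex)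
  then show ?thesis by blast
qed

text \<open>Test the defining identity at \<open>x = adjoint T y\<close>, apply Cauchy-Schwarz and
  cancel one factor \<open>norm (adjoint T y)\<close>.\<close>

lemma norm_adjoint_le:
  fixes T :: "'x::{real_inner, complete_space} \<Rightarrow> 'h::real_inner"
  assumes T: "bounded_linear T"
  shows "norm (adjoint T y) \<le> onorm T * norm y"
proof (cases "adjoint T y = 0")
  case False
  have "(norm (adjoint T y))\<^sup>2 = T (adjoint T y) \<bullet> y"
    by (simp add: adjoint_inner[OF T] power2_norm_eq_inner)
  also have "\<dots> \<le> norm (T (adjoint T y)) * norm y" by (rule norm_cauchy_schwarz)
  also have "\<dots> \<le> (onorm T * norm (adjoint T y)) * norm y"
    by (intro mult_right_mono onorm T) simp
  finally show ?thesis using False by (simp add: power2_eq_square)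
qed (simp add: onorm_pos_le T)

lemma bounded_linear_adjoint:
  fixes T :: "'x::{real_inner, complete_space} \<Rightarrow> 'h::real_inner"
  assumes T: "bounded_linear T"
  shows "bounded_linear (adjoint T)"
proof (rule bounded_linear_intro)
  show "adjoint T (x + y) = adjoint T x + adjoint T y" for x y
    by (subst vector_eq_ldot[symmetric]) (simp add: inner_add_right flip: adjoint_inner[OF T])
  show "adjoint T (c *\<^sub>R x) = c *\<^sub>R adjoint T x" for c x
    by (subst vector_eq_ldot[symmetric]) (simp flip: adjoint_inner[OF T])
  show "norm (adjoint T x) \<le> norm x * onorm T" for x
    using norm_adjoint_le[OF T, of x] by (simp add: mult.commute)
qed

text \<open>When the squared norm is expanded, the cross term
  \<open>- 2 * (norm (T x))\<^sup>2\<close> absorbs the square of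
  \<open>norm (adjoint T (T x))\<close>, which is at most \<open>norm (T x)\<close>.\<close>

lemma onorm_id_minus_adjoint_le:
  fixes T :: "'x::{real_inner, complete_space} \<Rightarrow> 'h::real_inner"
  assumes T: "bounded_linear T" and le: "onorm T \<le> 1"
  shows "onorm (\<lambda>x. x - adjoint T (T x)) \<le> 1"
proof (rule onorm_bound)
  fix x
  have "norm (adjoint T (T x)) \<le> norm (T x)"
    using norm_adjoint_le[OF T, of "T x"] mult_right_mono[OF le, of "norm (T x)"] by simp
  then have "(norm (adjoint T (T x)))\<^sup>2 \<le> (norm (T x))\<^sup>2" by (rule power_mono) simp
  moreover have "(norm (x - adjoint T (T x)))\<^sup>2 =
      (norm x)\<^sup>2 - 2 * (norm (T x))\<^sup>2 + (norm (adjoint T (T x)))\<^sup>2"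
    by (simp add: power2_norm_eq_inner inner_diff_left inner_diff_right adjoint_inner[OF T]
        inner_commute del: dot_square_norm)
  ultimately have "(norm (x - adjoint T (T x)))\<^sup>2 \<le> (norm x)\<^sup>2"
    using zero_le_power2[of "norm (T x)"] by linarith
  then have "norm (x - adjoint T (T x)) \<le> norm x" by (rule power2_le_imp_le) simp
  then show "norm (x - adjoint T (T x)) \<le> 1 * norm x" by simp
qed simp

section \<open>The contraction estimate for one thresholding step\<close>

lemma (in convex_lsc) thresholding_contraction:
  fixes T :: "'x \<Rightarrow> 'h::real_inner"
  assumes T: "bounded_linear T" and \<gamma>: "0 < \<gamma>"
    and s: "\<And>z. tikhonov T g \<gamma> P s \<le> tikhonov T g \<gamma> P z"
    and p: "\<And>z. tikhonov (\<lambda>z. z) (u + adjoint T (g - T u)) \<gamma> P p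
      \<le> tikhonov (\<lambda>z. z) (u + adjoint T (g - T u)) \<gamma> P z"
  shows "(1 + \<gamma>) * norm (s - p) \<le> onorm (\<lambda>x. x - adjoint T (T x)) * norm (s - u)"
proof -
  interpret T: bounded_linear T by (rule T)
  interpret T': bounded_linear "adjoint T" by (rule bounded_linear_adjoint[OF T])
  define R where "R = (\<lambda>x. x - adjoint T (T x))"
  have R: "bounded_linear R"
    unfolding R_def
    by (intro bounded_linear_sub bounded_linear_ident
        bounded_linear_compose[OF bounded_linear_adjoint[OF T] T])
  obtain a where a: "0 \<le> a" "P s = ennreal a" by (rule finite_minimizer[OF s])
  obtain c where c: "0 \<le> c" "P p = ennreal c" by (rule finite_minimizer[OF p])
  \<comment> \<open>\<open>T\<close> is moved across by the adjoint, so that both inequalities live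
    in the domain of \<open>T\<close> and can be added.\<close>
  have 1: "0 \<le> c - a + 2 * (adjoint T (T s - g) \<bullet> (p - s)) + 2 * \<gamma> * (s \<bullet> (p - s))"
    using minimizer_variational[OF T \<gamma> s a(2,1) c(2,1)]
    by (simp add: adjoint_inner[OF T] inner_commute[of "p - s" "adjoint T _"]
        inner_commute[of "T s - g"])
  have 2: "0 \<le> a - c + 2 * ((p - (u + adjoint T (g - T u))) \<bullet> (s - p)) + 2 * \<gamma> * (p \<bullet> (s - p))"
    by (rule minimizer_variational[OF bounded_linear_ident \<gamma> p c(2,1) a(2,1)])
  \<comment> \<open>Half the sum of \<open>1\<close> and \<open>2\<close>: \<open>a\<close>,
    \<open>c\<close> and the terms in \<open>g\<close> cancel, and writing \<open>p - u\<close> as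
    \<open>(s - u) - (s - p)\<close> produces both \<open>R (s - u)\<close> and the 1 in
    \<open>1 + \<gamma>\<close>.\<close>
  have "(1 + \<gamma>) * (norm (s - p))\<^sup>2 \<le> R (s - u) \<bullet> (s - p)"
    using 1 2 unfolding R_def
    by (simp add: power2_norm_eq_inner T.diff T'.diff inner_diff_left inner_diff_right
        inner_add_left inner_commute algebra_simps del: dot_square_norm)
  also have "\<dots> \<le> norm (R (s - u)) * norm (s - p)" by (rule norm_cauchy_schwarz)
  also have "\<dots> \<le> (onorm R * norm (s - u)) * norm (s - p)"
    by (intro mult_right_mono onorm R) simp
  finally have "((1 + \<gamma>) * norm (s - p)) * norm (s - p) \<le> (onorm R * norm (s - u)) * norm (s - p)"
    by (simp add: power2_eq_square mult.assoc)
  then show ?thesis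
    unfolding R_def[symmetric]
    by (cases "s = p") (simp_all add: onorm_pos_le[OF R])
qed

section \<open>The penalty\<close>

text \<open>For positive \<open>a\<close> and \<open>b\<close> this is \<open>powr_convex\<close>;
  if one of them is 0, it reduces to \<open>r powr p \<le> r\<close> for \<open>r\<close> in the
  unit interval.\<close>

lemma powr_convex_nonneg:
  fixes a b t p :: real
  assumes "1 \<le> p" "0 \<le> a" "0 \<le> b" "0 \<le> t" "t \<le> 1"
  shows "((1 - t) * a + t * b) powr p \<le> (1 - t) * a powr p + t * b powr p"
proof -
  have scale: "(r * x) powr p \<le> r * x powr p" if "0 \<le> r" "r \<le> 1" "0 \<le> x" for r x
    using that assms(1) powr_mono'[of 1 p r] by (simp add: powr_mult mult_right_mono)
  consider "a = 0" | "b = 0" | "0 < a" "0 < b" using assms by linarith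
  then show ?thesis
  proof cases
    case 3
    then show ?thesis
      using convex_onD[OF powr_convex[OF assms(1)] assms(4,5), of a b] by simp
  qed (use scale[of t b] scale[of "1 - t" a] assms in auto)
qed

section \<open>The l_q norms\<close>

lemma lq_norm_nonneg: "0 \<le> lq_norm q x"
  by (auto simp: lq_norm_def intro!: order_trans[OF abs_ge_zero Max_ge])

lemma lq_norm_0 [simp]: "lq_norm q 0 = 0"
  by (auto simp: lq_norm_def image_constant_conv)

lemma lq_norm_scaleR:
  assumes "1 \<le> q"
  shows "lq_norm q (c *\<^sub>R x) = \<bar>c\<bar> * lq_norm q x"
proof (cases q)
  case (real p)
  then have "1 \<le> p" using assms by simp
  then show ?thesis
    using real by (simp add: lq_norm_def abs_mult powr_mult powr_powr sum_nonneg flip: sum_distrib_left)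
next
  case PInf
  have "\<bar>c\<bar> * Max (range (\<lambda>k. \<bar>x $ k\<bar>)) = Max ((\<lambda>r. \<bar>c\<bar> * r) ` range (\<lambda>k. \<bar>x $ k\<bar>))"
    by (rule mono_Max_commute) (auto intro!: monoI mult_left_mono)
  then show ?thesis using PInf by (simp add: lq_norm_def abs_mult image_image)
qed (use assms in simp)

lemma lq_norm_powr:
  assumes "1 \<le> p"
  shows "lq_norm (ereal p) x powr p = (\<Sum>k\<in>UNIV. \<bar>x $ k\<bar> powr p)"
  using assms by (simp add: lq_norm_def powr_powr sum_nonneg)

lemma lq_norm_eq_0D:
  assumes "1 \<le> p" "lq_norm (ereal p) x = 0"
  shows "x = 0"
proof -
  have "(\<Sum>k\<in>UNIV. \<bar>x $ k\<bar> powr p) = 0"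
    using lq_norm_powr[OF assms(1), of x] assms by simp
  then show ?thesis by (simp add: sum_nonneg_eq_0_iff vec_eq_iff)
qed

text \<open>Convexity of \<open>t powr p\<close>, applied to the normalized vectors.\<close>

lemma lq_norm_triangle_finite:
  fixes x y :: "real ^ 'm"
  assumes p: "1 \<le> p"
  shows "lq_norm (ereal p) (x + y) \<le> lq_norm (ereal p) x + lq_norm (ereal p) y"
proof -
  define s where "s = lq_norm (ereal p) x"
  define r where "r = lq_norm (ereal p) y"
  consider "s = 0" | "r = 0" | "0 < s" "0 < r"
    using lq_norm_nonneg[of "ereal p" x] lq_norm_nonneg[of "ereal p" y] by (force simp: s_def r_def)
  then show ?thesis
  proof cases
    case 3
    \<comment> \<open>With this weight \<open>(x + y) / (s + r)\<close> is the convex combination of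
      the normalized vectors \<open>x / s\<close> and \<open>y / r\<close>.\<close>
    define t where "t = r / (s + r)"
    have t: "0 \<le> t" "t \<le> 1" and st: "(s + r) * (1 - t) = s" "(s + r) * t = r"
      using 3 by (auto simp: t_def field_simps)
    have k: "\<bar>(x + y) $ k\<bar> powr p \<le> (s + r) powr p *
        ((1 - t) * (\<bar>x $ k\<bar> powr p / s powr p) + t * (\<bar>y $ k\<bar> powr p / r powr p))" for k
    proof -
      have "\<bar>(x + y) $ k\<bar> \<le> \<bar>x $ k\<bar> + \<bar>y $ k\<bar>" by simp
      also have "\<dots> = (s + r) * ((1 - t) * (\<bar>x $ k\<bar> / s) + t * (\<bar>y $ k\<bar> / r))"
        unfolding distrib_left mult.assoc[symmetric] st using 3 by simp
      finally have "\<bar>(x + y) $ k\<bar> powr p \<le> \<dots> powr p" using p by (intro powr_mono2) auto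
      also have "\<dots> = (s + r) powr p * ((1 - t) * (\<bar>x $ k\<bar> / s) + t * (\<bar>y $ k\<bar> / r)) powr p"
        by (rule powr_mult)
      also have "\<dots> \<le> (s + r) powr p *
          ((1 - t) * (\<bar>x $ k\<bar> / s) powr p + t * (\<bar>y $ k\<bar> / r) powr p)"
        using 3 t p by (intro mult_left_mono powr_convex_nonneg) auto
      finally show ?thesis using 3 by (simp add: powr_divide)
    qed
    have s: "(\<Sum>k\<in>UNIV. \<bar>x $ k\<bar> powr p) / s powr p = 1"
      and r: "(\<Sum>k\<in>UNIV. \<bar>y $ k\<bar> powr p) / r powr p = 1"
      unfolding lq_norm_powr[OF p, symmetric] using 3 by (simp_all add: s_def r_def)
    have "lq_norm (ereal p) (x + y) powr p \<le> (\<Sum>k\<in>UNIV. (s + r) powr p *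
        ((1 - t) * (\<bar>x $ k\<bar> powr p / s powr p) + t * (\<bar>y $ k\<bar> powr p / r powr p)))"
      unfolding lq_norm_powr[OF p] by (intro sum_mono k)
    also have "\<dots> = (s + r) powr p *
        ((1 - t) * ((\<Sum>k\<in>UNIV. \<bar>x $ k\<bar> powr p) / s powr p) +
          t * ((\<Sum>k\<in>UNIV. \<bar>y $ k\<bar> powr p) / r powr p))"
      by (simp only: sum_distrib_left sum.distrib sum_divide_distrib distrib_left)
    also have "\<dots> = (s + r) powr p" unfolding s r by simp
    \<comment> \<open>The p-th root is taken by contraposition, using strict monotonicity of
      \<open>powr\<close>.\<close>
    finally have "lq_norm (ereal p) (x + y) \<le> s + r"
      using 3 p powr_less_mono2[of p "s + r" "lq_norm (ereal p) (x + y)"] by linarith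
    then show ?thesis by (simp add: s_def r_def)
  qed (use lq_norm_eq_0D[OF p, of x] lq_norm_eq_0D[OF p, of y] in \<open>auto simp: s_def r_def\<close>)
qed

lemma lq_norm_triangle:
  assumes "1 \<le> q"
  shows "lq_norm q (x + y) \<le> lq_norm q x + lq_norm q y"
proof (cases q)
  case (real p)
  then show ?thesis using lq_norm_triangle_finite assms by simp
next
  case PInf
  have "\<bar>(x + y) $ k\<bar> \<le> lq_norm q x + lq_norm q y" for k
  proof -
    have "\<bar>x $ k\<bar> \<le> lq_norm q x" "\<bar>y $ k\<bar> \<le> lq_norm q y"
      using PInf by (auto simp: lq_norm_def intro!: Max_ge)
    then show ?thesis by simp
  qed
  then have "Max (range (\<lambda>k. \<bar>(x + y) $ k\<bar>)) \<le> lq_norm q x + lq_norm q y"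
    by (subst Max_le_iff) auto
  then show ?thesis using PInf by (simp add: lq_norm_def)
qed (use assms in simp)

lemma convex_on_lq_norm:
  assumes "1 \<le> q"
  shows "convex_on UNIV (lq_norm q)"
proof (rule convex_onI)
  fix t :: real and x y :: "real ^ 'm"
  assume "0 < t" "t < 1"
  then show "lq_norm q ((1 - t) *\<^sub>R x + t *\<^sub>R y) \<le> (1 - t) * lq_norm q x + t * lq_norm q y"
    using lq_norm_triangle[OF assms, of "(1 - t) *\<^sub>R x" "t *\<^sub>R y"]
    by (simp add: lq_norm_scaleR[OF assms])
qed simp

lemma convex_on_power2_norm: "convex_on UNIV (\<lambda>x::'a::real_normed_vector. (norm x)\<^sup>2)"
proof (rule convex_onI)
  fix t :: real and x y :: 'a
  assume t: "0 < t" "t < 1"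
  have "norm ((1 - t) *\<^sub>R x + t *\<^sub>R y) \<le> (1 - t) * norm x + t * norm y"
    using t norm_triangle_ineq[of "(1 - t) *\<^sub>R x" "t *\<^sub>R y"] by simp
  then have "(norm ((1 - t) *\<^sub>R x + t *\<^sub>R y))\<^sup>2 \<le> ((1 - t) * norm x + t * norm y)\<^sup>2"
    by (rule power_mono) simp
  also have "\<dots> \<le> (1 - t) * (norm x)\<^sup>2 + t * (norm y)\<^sup>2"
    using convex_onD[OF convex_power2, of t "norm x" "norm y"] t by simp
  finally show "(norm ((1 - t) *\<^sub>R x + t *\<^sub>R y))\<^sup>2 \<le> (1 - t) * (norm x)\<^sup>2 + t * (norm y)\<^sup>2" .
qed simp

section \<open>The penalty as a sum over coordinates\<close>

lemma Psi_eq_infsum: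
  assumes "\<And>i. 0 \<le> v i" "\<And>i. 0 \<le> \<omega> i"
  shows "Psi q v \<omega> u =
    (\<Sum>\<^sub>\<infinity>i. ennreal (v i * lq_norm q (coord u i) + \<omega> i * (norm (coord u i))\<^sup>2))"
proof -
  have "Psi q v \<omega> u =
    (\<Sum>\<^sub>\<infinity>i. ennreal (v i * lq_norm q (coord u i)) + ennreal (\<omega> i * (norm (coord u i))\<^sup>2))"
    unfolding Psi_def by (rule infsum_add[symmetric]) (auto intro: nonneg_summable_on_complete)
  then show ?thesis
    by (simp add: ennreal_plus mult_nonneg_nonneg[OF assms(1) lq_norm_nonneg]
        mult_nonneg_nonneg[OF assms(2) zero_le_power2])
qed

text \<open>A sum in \<open>ennreal\<close> is the supremum of its finite partial sums. A bound on
  \<open>Psi\<close> thus becomes a family of real inequalities, each involving finitely many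
  coordinates.\<close>

lemma Psi_le_iff:
  fixes u :: "('i, real ^ 'm) ell2"
  assumes "\<And>i. 0 \<le> v i" "\<And>i. 0 \<le> \<omega> i" "0 \<le> c"
  shows "Psi q v \<omega> u \<le> ennreal c \<longleftrightarrow>
    (\<forall>F. finite F \<longrightarrow> (\<Sum>i\<in>F. v i * lq_norm q (coord u i) + \<omega> i * (norm (coord u i))\<^sup>2) \<le> c)"
proof -
  have "0 \<le> v i * lq_norm q x + \<omega> i * (norm x)\<^sup>2" for i and x :: "real ^ 'm"
    by (intro add_nonneg_nonneg mult_nonneg_nonneg assms lq_norm_nonneg zero_le_power2)
  then show ?thesis
    unfolding Psi_eq_infsum[OF assms(1,2)]
    by (subst nonneg_infsum_complete)
      (auto simp: SUP_le_iff sum_ennreal ennreal_le_iff[OF assms(3)])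
qed

text \<open>The remaining weights \<open>\<omega> i - \<gamma>\<close> are nonnegative, so what is
  left is a penalty of the same kind.\<close>

lemma Psi_split:
  fixes u :: "('i, real ^ 'm) ell2"
  assumes "0 \<le> \<gamma>" "\<And>i. \<gamma> \<le> \<omega> i"
  shows "Psi q v \<omega> u = ennreal (\<gamma> * (norm u)\<^sup>2) + Psi q v (\<lambda>i. \<omega> i - \<gamma>) u"
proof -
  have "(\<Sum>\<^sub>\<infinity>i. ennreal (\<omega> i * (norm (coord u i))\<^sup>2)) =
      (\<Sum>\<^sub>\<infinity>i. ennreal (\<gamma> * (norm (coord u i))\<^sup>2) + ennreal ((\<omega> i - \<gamma>) * (norm (coord u i))\<^sup>2))"
  proof (rule infsum_cong)
    fix i
    have "\<omega> i * (norm (coord u i))\<^sup>2 = \<gamma> * (norm (coord u i))\<^sup>2 + (\<omega> i - \<gamma>) * (norm (coord u i))\<^sup>2"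
      by (simp add: algebra_simps)
    then show "ennreal (\<omega> i * (norm (coord u i))\<^sup>2) =
        ennreal (\<gamma> * (norm (coord u i))\<^sup>2) + ennreal ((\<omega> i - \<gamma>) * (norm (coord u i))\<^sup>2)"
      using assms by (simp only: ennreal_plus mult_nonneg_nonneg zero_le_power2 diff_ge_0_iff_ge)
  qed
  also have "\<dots> = (\<Sum>\<^sub>\<infinity>i. ennreal (\<gamma> * (norm (coord u i))\<^sup>2)) +
      (\<Sum>\<^sub>\<infinity>i. ennreal ((\<omega> i - \<gamma>) * (norm (coord u i))\<^sup>2))"
    by (rule infsum_add) (auto intro: nonneg_summable_on_complete)
  \<comment> \<open>Passing to a real sum relies on square summability of \<open>u\<close>; both
    sides are suprema of the same finite sums.\<close>
  also have "(\<Sum>\<^sub>\<infinity>i. ennreal (\<gamma> * (norm (coord u i))\<^sup>2)) = ennreal (\<Sum>\<^sub>\<infinity>i. \<gamma> * (norm (coord u i))\<^sup>2)"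
    using assms(1)
    by (subst infsum_nonneg_is_SUPREMUM_ennreal)
      (auto simp: nonneg_infsum_complete sum_ennreal intro!: summable_on_cmult_right coord_summable)
  also have "(\<Sum>\<^sub>\<infinity>i. \<gamma> * (norm (coord u i))\<^sup>2) = \<gamma> * (norm u)\<^sup>2"
    unfolding norm_ell2_power2 by (rule infsum_cmult_right) (rule coord_summable)
  finally show ?thesis by (simp add: Psi_def ac_simps)
qed

lemma tendsto_coord:
  assumes "X \<longlonglongrightarrow> x"
  shows "(\<lambda>n. coord (X n) i) \<longlonglongrightarrow> coord x i"
proof (rule metric_tendsto_imp_tendsto[OF assms])
  show "\<forall>\<^sub>F n in sequentially. dist (coord (X n) i) (coord x i) \<le> dist (X n) x"
    by (intro always_eventually allI) (metis dist_norm minus_ell2.rep_eq norm_coord_le)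
qed

text \<open>Convexity and continuity hold for each summand \<open>\<phi> i\<close>, hence for finite
  sums; \<open>Psi_le_iff\<close> carries the resulting bounds over to \<open>Psi\<close>.\<close>

lemma convex_lsc_Psi:
  fixes v \<omega> :: "'i \<Rightarrow> real"
  assumes q: "1 \<le> q" and v: "\<And>i. 0 \<le> v i" and \<omega>: "\<And>i. 0 \<le> \<omega> i"
  shows "convex_lsc (Psi q v \<omega> :: ('i, real ^ 'm) ell2 \<Rightarrow> ennreal)"
proof
  define \<phi> where "\<phi> = (\<lambda>i (x :: real ^ 'm). v i * lq_norm q x + \<omega> i * (norm x)\<^sup>2)"
  have conv: "convex_on UNIV (\<phi> i)" for i
    unfolding \<phi>_def
    by (intro convex_on_add convex_on_cmul convex_on_lq_norm convex_on_power2_norm q v \<omega>)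
  have \<phi>0: "0 \<le> \<phi> i x" for i x
    unfolding \<phi>_def
    by (intro add_nonneg_nonneg mult_nonneg_nonneg v \<omega> lq_norm_nonneg zero_le_power2)
  have le_iff: "Psi q v \<omega> u \<le> ennreal c \<longleftrightarrow> (\<forall>F. finite F \<longrightarrow> (\<Sum>i\<in>F. \<phi> i (coord u i)) \<le> c)"
    if "0 \<le> c" for u :: "('i, real ^ 'm) ell2" and c
    unfolding \<phi>_def by (rule Psi_le_iff[OF v \<omega> that])
  show "Psi q v \<omega> (0 :: ('i, real ^ 'm) ell2) < top"
    by (simp add: Psi_def zero_ell2.rep_eq)
  show "Psi q v \<omega> ((1 - t) *\<^sub>R x + t *\<^sub>R y) \<le> ennreal ((1 - t) * a + t * b)"
    if x: "Psi q v \<omega> x \<le> ennreal a" and y: "Psi q v \<omega> y \<le> ennreal b"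
      and ab: "0 \<le> a" "0 \<le> b" and t: "0 \<le> t" "t \<le> 1"
    for x y :: "('i, real ^ 'm) ell2" and a b t
  proof -
    have "(\<Sum>i\<in>F. \<phi> i (coord ((1 - t) *\<^sub>R x + t *\<^sub>R y) i)) \<le> (1 - t) * a + t * b" if "finite F" for F
    proof -
      have "(\<Sum>i\<in>F. \<phi> i (coord ((1 - t) *\<^sub>R x + t *\<^sub>R y) i)) \<le>
          (\<Sum>i\<in>F. (1 - t) * \<phi> i (coord x i) + t * \<phi> i (coord y i))"
        unfolding plus_ell2.rep_eq scaleR_ell2.rep_eq
        by (intro sum_mono convex_onD[OF conv t] UNIV_I)
      also have "\<dots> = (1 - t) * (\<Sum>i\<in>F. \<phi> i (coord x i)) + t * (\<Sum>i\<in>F. \<phi> i (coord y i))"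
        by (simp add: sum.distrib sum_distrib_left)
      also have "\<dots> \<le> (1 - t) * a + t * b"
        using x y ab t that by (intro add_mono mult_left_mono) (auto simp: le_iff)
      finally show ?thesis .
    qed
    then show ?thesis using ab t by (subst le_iff) auto
  qed
  show "Psi q v \<omega> x \<le> ennreal b"
    if X: "X \<longlonglongrightarrow> x" and c: "c \<longlonglongrightarrow> b" and le: "\<And>n. Psi q v \<omega> (X n) \<le> ennreal (c n)"
    for X and x :: "('i, real ^ 'm) ell2" and c b
  proof -
    \<comment> \<open>The bounds \<open>c n\<close> may be negative, whereas \<open>le_iff\<close>
      requires nonnegative ones; \<open>max 0\<close> leaves the value under \<open>ennreal\<close>
      unchanged.\<close>
    have le': "Psi q v \<omega> (X n) \<le> ennreal (max 0 (c n))" for n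
      by (rule order_trans[OF le]) (simp add: ennreal_leI)
    have "(\<Sum>i\<in>F. \<phi> i (coord x i)) \<le> max 0 b" if F: "finite F" for F
    proof (rule LIMSEQ_le)
      \<comment> \<open>A convex function on all of a finite-dimensional space is
        continuous.\<close>
      have "isCont (\<phi> i) z" for i z
        using convex_on_continuous[OF open_UNIV conv] by (simp add: continuous_on_eq_continuous_at)
      then show "(\<lambda>n. \<Sum>i\<in>F. \<phi> i (coord (X n) i)) \<longlonglongrightarrow> (\<Sum>i\<in>F. \<phi> i (coord x i))"
        by (intro tendsto_sum isCont_tendsto_compose[OF _ tendsto_coord[OF X]])
      show "(\<lambda>n. max 0 (c n)) \<longlonglongrightarrow> max 0 b" by (intro tendsto_intros c)
      show "\<exists>N. \<forall>n\<ge>N. (\<Sum>i\<in>F. \<phi> i (coord (X n) i)) \<le> max 0 (c n)"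
        using le' F by (simp add: le_iff)
    qed
    then have "Psi q v \<omega> x \<le> ennreal (max 0 b)" by (subst le_iff) auto
    then show ?thesis by (simp add: max_def ennreal_neg split: if_splits)
  qed
qed

section \<open>Chosen minimizers and linear convergence\<close>

lemma arg_min_le:
  fixes f :: "'a \<Rightarrow> 'b::linorder"
  assumes "\<exists>p. \<forall>z. f p \<le> f z"
  shows "f (arg_min f (\<lambda>_. True)) \<le> f z"
proof -
  obtain p where "\<forall>z. f p \<le> f z" using assms ..
  then have "is_arg_min f (\<lambda>_. True) p" by (auto simp: is_arg_min_def not_less)
  then have "is_arg_min f (\<lambda>_. True) (arg_min f (\<lambda>_. True))"
    unfolding arg_min_def by (rule someI)
  then show ?thesis by (auto simp: is_arg_min_def not_less)
qed

theorem proposition5p1: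
  fixes T :: "('i::countable, real ^ 'm) ell2 \<Rightarrow> 'h::{real_inner, complete_space, second_countable_topology}"
    and g :: 'h
    and v \<omega> :: "'i \<Rightarrow> real"
    and q :: ereal
    and \<gamma> \<alpha> :: real
    and u :: "nat \<Rightarrow> ('i, real ^ 'm) ell2"
  assumes "bounded_linear T"
    and "onorm T < 1"
    and "1 \<le> q"
    and "\<And>i. 0 \<le> v i"
    and "0 < \<gamma>"
    and "\<And>i. \<gamma> \<le> \<omega> i"
    and "\<alpha> = inverse (1 + \<gamma>) * onorm (\<lambda>x. x - adjoint T (T x))"
    and "\<And>m. u (Suc m) = thresh q v \<omega> (u m + adjoint T (g - T (u m)))"
  shows "\<alpha> < 1 \<and>
    (\<forall>m. norm (K_minimizer q v \<omega> T g - u (Suc m)) \<le> \<alpha> * norm (K_minimizer q v \<omega> T g - u m))"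
proof (intro conjI allI)
  \<comment> \<open>The operator norm of \<open>I - adjoint T T\<close> is at most 1; strictness
    comes from \<open>1 + \<gamma> > 1\<close>.\<close>
  show "\<alpha> < 1"
    using onorm_id_minus_adjoint_le[OF assms(1)] assms(2,5) by (simp add: assms(7) field_simps)
next
  fix m
  define P :: "('i, real ^ 'm) ell2 \<Rightarrow> ennreal" where "P = Psi q v (\<lambda>i. \<omega> i - \<gamma>)"
  interpret convex_lsc P
    unfolding P_def by (rule convex_lsc_Psi) (use assms in auto)
  note split = Psi_split[OF less_imp_le[OF assms(5)], of \<omega>, OF assms(6)]
  have K: "K_functional q v \<omega> T g = tikhonov T g \<gamma> P"
    using assms(5) by (auto simp: K_functional_def tikhonov_def P_def split add.assoc)
  \<comment> \<open>Thresholding at \<open>w\<close> is the case of the identity operator with data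
    \<open>w\<close>, with the same \<open>\<gamma>\<close> and \<open>P\<close> as in
    \<open>K\<close>.\<close>
  have U: "(\<lambda>z. ennreal ((norm (w - z))\<^sup>2) + Psi q v \<omega> z) = tikhonov (\<lambda>z. z) w \<gamma> P" for w
    using assms(5) by (auto simp: tikhonov_def P_def split add.assoc norm_minus_commute)
  have "(1 + \<gamma>) * norm (K_minimizer q v \<omega> T g - u (Suc m)) \<le>
      onorm (\<lambda>x. x - adjoint T (T x)) * norm (K_minimizer q v \<omega> T g - u m)"
  proof (rule thresholding_contraction[OF assms(1,5)])
    show "tikhonov T g \<gamma> P (K_minimizer q v \<omega> T g) \<le> tikhonov T g \<gamma> P z" for z
      unfolding K_minimizer_def K
      by (intro arg_min_le exists_minimizer assms(1,5))
    show "tikhonov (\<lambda>z. z) (u m + adjoint T (g - T (u m))) \<gamma> P (u (Suc m))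
        \<le> tikhonov (\<lambda>z. z) (u m + adjoint T (g - T (u m))) \<gamma> P z" for z
      unfolding assms(8) thresh_def U
      by (intro arg_min_le exists_minimizer bounded_linear_ident assms(5))
  qed
  then show "norm (K_minimizer q v \<omega> T g - u (Suc m)) \<le> \<alpha> * norm (K_minimizer q v \<omega> T g - u m)"
    using assms(5) by (simp add: assms(7) field_simps)
qed

end
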